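(* Let $G$ be a finite additive group and let $A,B$ be subsets of $G$, with complements $\overline{A} = G\setminus A$ and $\overline{B} = G \setminus B$. Then \[ r(A,B,B) + r(\overline{A},\overline{B},\overline{B}) = |A|\cdot|B| - |A|\cdot|\overline{B}| + |\overline{B}|^2. \]
   Context: For subsets $X,Y$ of $G$, $r(X,Y,Y)$ denotes the number of triples $(x,y,x+y)$ with $x \in X$, $y\in Y$ and $x+y \in Y$. *)

theory Defs imports Main begin

definition triple_count :: "'a::group_add set \<Rightarrow> 'a set \<Rightarrow> 'a set \<Rightarrow> nat" where
  "triple_count X Y Z = card {(x, y, x + y) |x y. x \<in> X \<and> y \<in> Y \<and> x + y \<in> Z}"

end

theory Submission imports Defs begin

text \<open>Two of the three entries of a triple \<open>(x, y, x + y)\<close> determine the third, so the count is a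
  plain product of cardinalities as soon as one of the three sets is the whole group. Splitting over
  the third set, then the first, then the second,
  \<open>r(A,B,B) = |A||B| - r(A,B,-B)\<close> and \<open>r(-A,-B,-B) = |-B|\<^sup>2 - r(A,-B,-B)\<close>, while
  \<open>r(A,B,-B) + r(A,-B,-B) = r(A,G,-B) = |A||-B|\<close>.\<close>

text \<open>The third entry is a function of the first two, so appending it to a pair is injective
  and preserves cardinality.\<close>

lemma triple_count_eq_card_pairs:
  "triple_count X Y Z = card {(x, y). x \<in> X \<and> y \<in> Y \<and> x + y \<in> Z}"
proof -
  have "{(x, y, x + y) |x y. x \<in> X \<and> y \<in> Y \<and> x + y \<in> Z} =
        (\<lambda>(x, y). (x, y, x + y)) ` {(x, y). x \<in> X \<and> y \<in> Y \<and> x + y \<in> Z}"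
    by auto
  moreover have "inj_on (\<lambda>(x, y). (x, y, x + y)) {(x, y). x \<in> X \<and> y \<in> Y \<and> x + y \<in> Z}"
    by (auto simp: inj_on_def)
  ultimately show ?thesis
    by (simp add: triple_count_def card_image)
qed

context
  fixes X Y Z :: "'a::{finite, group_add} set"
begin

text \<open>Each pair has its first entry in exactly one of \<open>X\<close> and \<open>- X\<close>;
  the finite type makes both classes finite, so their cardinalities add.\<close>

lemma triple_count_split_first:
  "triple_count X Y Z + triple_count (- X) Y Z = triple_count UNIV Y Z"
  unfolding triple_count_eq_card_pairs
  by (subst card_Un_disjoint[symmetric]) (auto intro!: arg_cong[where f = card])

lemma triple_count_split_second:
  "triple_count X Y Z + triple_count X (- Y) Z = triple_count X UNIV Z"
  unfolding triple_count_eq_card_pairs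
  by (subst card_Un_disjoint[symmetric]) (auto intro!: arg_cong[where f = card])

lemma triple_count_split_third:
  "triple_count X Y Z + triple_count X Y (- Z) = triple_count X Y UNIV"
proof -
  have "{(x, y). x \<in> X \<and> y \<in> Y \<and> x + y \<in> UNIV} =
      {(x, y). x \<in> X \<and> y \<in> Y \<and> x + y \<in> Z} \<union> {(x, y). x \<in> X \<and> y \<in> Y \<and> x + y \<in> - Z}"
    by auto
  then show ?thesis
    unfolding triple_count_eq_card_pairs
    by (simp only:) (rule card_Un_disjoint[symmetric]; auto)
qed

lemma triple_count_UNIV_first: "triple_count UNIV Y Z = card Y * card Z"
proof -
  have "bij_betw (\<lambda>(x, y). (y, x + y)) {(x, y). x \<in> UNIV \<and> y \<in> Y \<and> x + y \<in> Z} (Y \<times> Z)"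
    \<comment> \<open>Solving \<open>x + y = z\<close> for \<open>x\<close> cancels \<open>y\<close>
      on the right, which gives \<open>z - y\<close>.\<close>
    by (rule bij_betw_byWitness[where f' = "\<lambda>(y, z). (z - y, y)"]) auto
  then show ?thesis
    by (simp add: triple_count_eq_card_pairs bij_betw_same_card card_cartesian_product)
qed

lemma triple_count_UNIV_second: "triple_count X UNIV Z = card X * card Z"
proof -
  have "bij_betw (\<lambda>(x, y). (x, x + y)) {(x, y). x \<in> X \<and> y \<in> UNIV \<and> x + y \<in> Z} (X \<times> Z)"
    \<comment> \<open>Here \<open>x\<close> has to be cancelled on the left:
      \<open>group_add\<close> is not commutative, so the solution is \<open>- x + z\<close>, not
      \<open>z - x\<close>.\<close>
    by (rule bij_betw_byWitness[where f' = "\<lambda>(x, z). (x, - x + z)"]) (auto simp: add.assoc[symmetric])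
  then show ?thesis
    by (simp add: triple_count_eq_card_pairs bij_betw_same_card card_cartesian_product)
qed

lemma triple_count_UNIV_third: "triple_count X Y UNIV = card X * card Y"
proof -
  have "{(x, y). x \<in> X \<and> y \<in> Y \<and> x + y \<in> UNIV} = X \<times> Y"
    by auto
  then show ?thesis
    by (simp add: triple_count_eq_card_pairs card_cartesian_product)
qed

end

theorem theorem5:
  fixes A B :: "'a::{finite, group_add} set"
  shows "int (triple_count A B B) + int (triple_count (- A) (- B) (- B)) =
         int (card A) * int (card B) - int (card A) * int (card (- B)) + (int (card (- B)))\<^sup>2"
proof -
  have "int (triple_count A B B) + int (triple_count A B (- B)) = int (card A) * int (card B)"
    by (metis triple_count_split_third triple_count_UNIV_third of_nat_add of_nat_mult)
  moreover have "int (triple_count A (- B) (- B)) + int (triple_count (- A) (- B) (- B)) =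
      (int (card (- B)))\<^sup>2"
    by (metis triple_count_split_first triple_count_UNIV_first of_nat_add of_nat_mult power2_eq_square)
  moreover have "int (triple_count A B (- B)) + int (triple_count A (- B) (- B)) =
      int (card A) * int (card (- B))"
    by (metis triple_count_split_second triple_count_UNIV_second of_nat_add of_nat_mult)
  \<comment> \<open>The sum of the first two equations minus the third cancels both mixed counts,
    \<open>r(A,B,-B)\<close> and \<open>r(A,-B,-B)\<close>.\<close>
  ultimately show ?thesis
    by linarith
qed

end
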